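(* For each $j=1,\dots,m$, let $\mathcal{H}_j$ be a real Euclidean space, let the set $\mathcal{M}_j\subset\mathcal{H}_j$ contain the point $\bar x_j$, and let the set-valued operator $A_j:\mathcal{H}_j\rightrightarrows\mathcal{H}_j$ be partly smooth at $\bar x_j$ relative to $\mathcal{M}_j$. Then the set-valued operator $\boldsymbol{A}:\mathcal{H}_1\times\cdots\times\mathcal{H}_m\rightrightarrows\mathcal{H}_1\times\cdots\times\mathcal{H}_m$ defined by $$\boldsymbol{A}(x_1,\dots,x_m)=\{(v_1,\dots,v_m): v_j\in A_j(x_j),\ j=1,\dots,m\}$$ is partly smooth at $(\bar x_1,\dots,\bar x_m)$ relative to $\mathcal{M}_1\times\cdots\times\mathcal{M}_m$.
   Context: Notation. For a convex set $S$, $\operatorname{Lin}(S)=\operatorname{Aff}(S)-x$ ($x\in S$) is the linear subspace parallel to the affine hull of $S$. $T_{\mathcal{M}}(x)$, $N_{\mathcal{M}}(x)$ are the tangent and normal spaces of the manifold $\mathcal{M}$ at $x\in\mathcal{M}$; $P_V$ is the orthogonal projection onto $V$. Semicontinuity. A set-valued operator $A$ is lower semi-continuous at $\bar x$ if for every $\bar u\in A(\bar x)$ and every sequence $x^{(k)}\in\operatorname{dom}A$ with $x^{(k)}\to\bar x$ there are $u^{(k)}\in A(x^{(k)})$ with $u^{(k)}\to\bar u$. $A$ is upper semi-continuous at $\bar x$ if $x^{(k)}\to\bar x$, $u^{(k)}\in A(x^{(k)})$, $u^{(k)}\to\bar u$ imply $\bar u\in A(\bar x)$. $A$ is upper semi-continuous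 if it is so at every point of its domain. Continuous along $\mathcal{M}$ means both lower and upper semi-continuous with sequences restricted to $\mathcal{M}$. Partly smooth operator. A set-valued operator $A$ on a Euclidean space is partly smooth at $\bar x$ relative to a set $\mathcal{M}\ni\bar x$ if $\mathcal{M}$ is a $C^p$-manifold ($p\ge1$) around $\bar x$, $A$ is upper semi-continuous, and: (Regularity) for every $x$ close to $\bar x$, $A(x)$ is nonempty, closed and convex; (Sharpness) $N_{\mathcal{M}}(\bar x)=\operatorname{Lin}(A(\bar x))$, and $x\mapsto P_{T_{\mathcal{M}}(x)}(A(x))$ is single-valued and continuous around $\bar x$ along $\mathcal{M}$; (Continuity) $A$ is continuous along $\mathcal{M}$ near $\bar x$. *)

theory Defs
  imports "HOL-Analysis.Analysis"
begin

text \<open>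
  A Euclidean space is represented by a linear subspace \<open>H\<close> of a type of class
  \<open>euclidean_space\<close>, with the induced inner product and topology. This allows a finite family of
  Euclidean spaces of different dimensions: spaces \<open>H j\<close> inside a common type \<open>'a\<close> have the
  product \<open>{x. \<forall>j. x $ j \<in> H j}\<close> inside \<open>'a ^ 'm\<close>. The choice \<open>H = UNIV\<close> gives the usual notions.
\<close>

definition cart_prod :: "('m::finite \<Rightarrow> 'a set) \<Rightarrow> ('a ^ 'm) set" where
  "cart_prod S = {x. \<forall>j. x $ j \<in> S j}"

definition prod_operator :: "('m::finite \<Rightarrow> 'a \<Rightarrow> 'a set) \<Rightarrow> 'a ^ 'm \<Rightarrow> ('a ^ 'm) set" where
  "prod_operator A x = {v. \<forall>j. v $ j \<in> A j (x $ j)}"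

text \<open>Class \<open>C\<^sup>k\<close>, for open \<open>S\<close>: all iterated directional derivatives up to order \<open>k\<close> exist (as
  Frechet derivatives of the preceding ones) and are continuous.\<close>

primrec Ck_on :: "nat \<Rightarrow> 'a::euclidean_space set \<Rightarrow> ('a \<Rightarrow> 'b::euclidean_space) \<Rightarrow> bool" where
  "Ck_on 0 S f \<longleftrightarrow> continuous_on S f"
| "Ck_on (Suc k) S f \<longleftrightarrow>
     (\<forall>x\<in>S. f differentiable (at x)) \<and> (\<forall>v. Ck_on k S (\<lambda>x. frechet_derivative f (at x) v))"

text \<open>Embedded submanifold near \<open>x\<close>: a \<open>C\<^sup>p\<close> diffeomorphism \<open>\<phi>\<close> between open sets flattens \<open>M\<close> to
  a piece of a linear subspace. A subset of a subspace \<open>H\<close> is a submanifold of \<open>H\<close> iff it is one of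
  the whole type, so \<open>H\<close> does not enter here.\<close>

definition Cp_manifold_around :: "nat \<Rightarrow> 'a::euclidean_space set \<Rightarrow> 'a \<Rightarrow> bool" where
  "Cp_manifold_around p M x \<longleftrightarrow> x \<in> M \<and>
     (\<exists>U W \<phi> \<psi> L. open U \<and> x \<in> U \<and> open W \<and> subspace (L :: 'a set) \<and>
        homeomorphism U W \<phi> \<psi> \<and> Ck_on p U \<phi> \<and> Ck_on p W \<psi> \<and> \<phi> ` (M \<inter> U) = L \<inter> W)"

text \<open>Velocities at \<open>x\<close> of \<open>C\<^sup>1\<close> curves in \<open>M\<close> through \<open>x\<close>.\<close>

definition tangent_space :: "'a::euclidean_space set \<Rightarrow> 'a \<Rightarrow> 'a set" where
  "tangent_space M x = {v. \<exists>\<gamma> e. e > 0 \<and> \<gamma> C1_differentiable_on {-e<..<e} \<and>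
     \<gamma> ` {-e<..<e} \<subseteq> M \<and> \<gamma> 0 = x \<and> (\<gamma> has_vector_derivative v) (at 0)}"

definition normal_space :: "'a::euclidean_space set \<Rightarrow> 'a set \<Rightarrow> 'a \<Rightarrow> 'a set" where
  "normal_space H M x = {n \<in> H. \<forall>t \<in> tangent_space M x. orthogonal n t}"

text \<open>The set \<open>affine hull S - x\<close> is the same for all \<open>x \<in> S\<close>.\<close>

definition Lin :: "'a::euclidean_space set \<Rightarrow> 'a set" where
  "Lin S = {y - x | x y. x \<in> S \<and> y \<in> affine hull S}"

text \<open>Semicontinuity with sequences restricted to \<open>S\<close>.\<close>

definition lsc_at_along :: "'a::euclidean_space set \<Rightarrow> ('a \<Rightarrow> 'a set) \<Rightarrow> 'a \<Rightarrow> bool" where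
  "lsc_at_along S A x \<longleftrightarrow>
     (\<forall>u \<in> A x. \<forall>X. (\<forall>k. X k \<in> S \<and> A (X k) \<noteq> {}) \<and> X \<longlonglongrightarrow> x \<longrightarrow>
        (\<exists>V. (\<forall>k::nat. V k \<in> A (X k)) \<and> V \<longlonglongrightarrow> u))"

definition usc_at_along :: "'a::euclidean_space set \<Rightarrow> ('a \<Rightarrow> 'a set) \<Rightarrow> 'a \<Rightarrow> bool" where
  "usc_at_along S A x \<longleftrightarrow>
     (\<forall>X V u. (\<forall>k::nat. X k \<in> S \<and> V k \<in> A (X k)) \<and> X \<longlonglongrightarrow> x \<and> V \<longlonglongrightarrow> u \<longrightarrow> u \<in> A x)"

definition upper_semicontinuous :: "'a::euclidean_space set \<Rightarrow> ('a \<Rightarrow> 'a set) \<Rightarrow> bool" where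
  "upper_semicontinuous H A \<longleftrightarrow> (\<forall>x\<in>H. A x \<noteq> {} \<longrightarrow> usc_at_along H A x)"

definition regularity :: "'a::euclidean_space set \<Rightarrow> ('a \<Rightarrow> 'a set) \<Rightarrow> 'a \<Rightarrow> bool" where
  "regularity H A xb \<longleftrightarrow>
     (\<forall>\<^sub>F x in nhds xb. x \<in> H \<longrightarrow> A x \<noteq> {} \<and> closed (A x) \<and> convex (A x))"

text \<open>Near \<open>xb\<close> the tangent space is a linear subspace, so that \<open>closest_point\<close> is the orthogonal
  projection onto it.\<close>

definition sharpness ::
  "'a::euclidean_space set \<Rightarrow> ('a \<Rightarrow> 'a set) \<Rightarrow> 'a set \<Rightarrow> 'a \<Rightarrow> bool" where
  "sharpness H A M xb \<longleftrightarrow>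
     normal_space H M xb = Lin (A xb) \<and>
     (\<exists>U f. open U \<and> xb \<in> U \<and> continuous_on (M \<inter> U) f \<and>
        (\<forall>x \<in> M \<inter> U. closest_point (tangent_space M x) ` A x = {f x}))"

definition continuity_along :: "('a::euclidean_space \<Rightarrow> 'a set) \<Rightarrow> 'a set \<Rightarrow> 'a \<Rightarrow> bool" where
  "continuity_along A M xb \<longleftrightarrow>
     (\<forall>\<^sub>F x in nhds xb. x \<in> M \<longrightarrow> lsc_at_along M A x \<and> usc_at_along M A x)"

text \<open>The operator is \<open>A\<close> restricted to \<open>H\<close>; its values outside \<open>H\<close> are irrelevant.\<close>

definition partly_smooth ::
  "nat \<Rightarrow> 'a::euclidean_space set \<Rightarrow> ('a \<Rightarrow> 'a set) \<Rightarrow> 'a set \<Rightarrow> 'a \<Rightarrow> bool" where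
  "partly_smooth p H A M xb \<longleftrightarrow>
     subspace H \<and> (\<forall>x\<in>H. A x \<subseteq> H) \<and> M \<subseteq> H \<and> xb \<in> M \<and>
     1 \<le> p \<and> Cp_manifold_around p M xb \<and>
     upper_semicontinuous H A \<and>
     regularity H A xb \<and> sharpness H A M xb \<and> continuity_along A M xb"

end

theory Submission
  imports Defs
begin

text \<open>
  Each ingredient of partial smoothness is computed componentwise: tangent spaces, normal spaces,
  affine hulls and flattening diffeomorphisms of a product are the products of those of the factors.
  The projection onto a product is the product of the projections once the
  tangent spaces are closed and convex; near the base point they are linear subspaces, namely
  images of the flattened subspace under the derivative of the inverse chart.
\<close>

section \<open>Finite products\<close>

lemma mem_cart_prod [simp]: "x \<in> cart_prod S \<longleftrightarrow> (\<forall>j. x $ j \<in> S j)"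
  by (simp add: cart_prod_def)

lemma prod_operator_eq: "prod_operator A x = cart_prod (\<lambda>j. A j (x $ j))"
  by (simp add: prod_operator_def cart_prod_def)

lemma open_cart_prod: "(\<And>j. open (S j)) \<Longrightarrow> open (cart_prod S)"
  unfolding cart_prod_def by (rule open_vector_box) simp

lemma closed_cart_prod: "(\<And>j. closed (S j)) \<Longrightarrow> closed (cart_prod S)"
  unfolding cart_prod_def by (rule closed_vector_box) simp

lemma convex_cart_prod: "(\<And>j. convex (S j)) \<Longrightarrow> convex (cart_prod S)"
  by (simp add: convex_def)

lemma affine_cart_prod: "(\<And>j. affine (S j)) \<Longrightarrow> affine (cart_prod S)"
  by (simp add: affine_def)

lemma subspace_cart_prod: "(\<And>j. subspace (S j)) \<Longrightarrow> subspace (cart_prod S)"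
  by (simp add: subspace_def)

text \<open>Points picked in the factors assemble to a point of the product. Applied to the values
  of \<open>prod_operator\<close>, this says that its domain is described coordinate by
  coordinate.\<close>

lemma cart_prod_eq_empty_iff: "cart_prod S = {} \<longleftrightarrow> (\<exists>j. S j = {})"
proof
  show "cart_prod S = {} \<Longrightarrow> \<exists>j. S j = {}"
  proof (rule ccontr)
    assume empty: "cart_prod S = {}" and "\<nexists>j. S j = {}"
    then have "(SOME y. y \<in> S j) \<in> S j" for j
      by (simp add: some_in_eq)
    then have "(\<chi> j. SOME y. y \<in> S j) \<in> cart_prod S"
      by simp
    with empty show False by simp
  qed
next
  show "\<exists>j. S j = {} \<Longrightarrow> cart_prod S = {}"
    unfolding cart_prod_def by blast
qed

lemma cart_prod_singleton: "cart_prod (\<lambda>j. {f j}) = {\<chi> j. f j}"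
  by (auto simp: vec_eq_iff)

lemma cart_prod_Int: "cart_prod S \<inter> cart_prod T = cart_prod (\<lambda>j. S j \<inter> T j)"
  by auto

lemma image_cart_prod:
  "(\<lambda>x. \<chi> j. f j (x $ j)) ` cart_prod S = cart_prod (\<lambda>j. f j ` S j)"
proof
  show "cart_prod (\<lambda>j. f j ` S j) \<subseteq> (\<lambda>x. \<chi> j. f j (x $ j)) ` cart_prod S"
  proof
    fix y assume "y \<in> cart_prod (\<lambda>j. f j ` S j)"
    then have "\<forall>j. \<exists>s. s \<in> S j \<and> y $ j = f j s" by auto
    then obtain s where "\<forall>j. s j \<in> S j \<and> y $ j = f j (s j)" by metis
    then show "y \<in> (\<lambda>x. \<chi> j. f j (x $ j)) ` cart_prod S"
      by (intro image_eqI[where x = "\<chi> j. s j"]) (auto simp: vec_eq_iff)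
  qed
qed auto

text \<open>Coordinate maps are continuous, and only finitely many neighbourhoods have to be
  intersected.\<close>

lemma eventually_nhds_vec_nth:
  assumes "\<And>j. \<forall>\<^sub>F y in nhds (x $ j). P j y"
  shows "\<forall>\<^sub>F x' in nhds x. \<forall>j. P j (x' $ j)"
proof (rule eventually_all_finite)
  fix j
  have "((\<lambda>x'. x' $ j) \<longlongrightarrow> x $ j) (nhds x)"
    by (intro tendsto_vec_nth) (simp add: filterlim_ident)
  then show "\<forall>\<^sub>F x' in nhds x. P j (x' $ j)"
    using assms[of j] by (simp add: filterlim_iff)
qed

lemma affine_hull_cart_prod:
  fixes S :: "'m::finite \<Rightarrow> 'a::euclidean_space set"
  shows "affine hull cart_prod S = cart_prod (\<lambda>j. affine hull S j)"
proof
  show "affine hull cart_prod S \<subseteq> cart_prod (\<lambda>j. affine hull S j)"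
    by (intro hull_minimal subsetI affine_cart_prod affine_affine_hull) (simp add: hull_inc)
next
  text \<open>Coordinates are moved from \<open>S j\<close> to \<open>affine hull S j\<close> one at a time.\<close>
  have *: "y \<in> affine hull cart_prod S"
    if "finite J" "\<forall>j\<in>J. y $ j \<in> affine hull S j" "\<forall>j. j \<notin> J \<longrightarrow> y $ j \<in> S j" for J y
    using that
  proof (induction J arbitrary: y rule: finite_induct)
    case empty
    then show ?case by (auto intro: hull_inc)
  next
    case (insert i J)
    \<comment> \<open>As the other coordinates stay fixed, \<open>upd\<close> is an affine map and
      in general not a linear one, whence the condition \<open>u + v = 1\<close> below.\<close>
    define upd where "upd t = (\<chi> j. if j = i then t else y $ j)" for t
    have upd_comb: "upd (u *\<^sub>R s + v *\<^sub>R t) = u *\<^sub>R upd s + v *\<^sub>R upd t" if "u + v = 1" for u v s t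
      using that by (auto simp: upd_def vec_eq_iff scaleR_left_distrib[symmetric])
    \<comment> \<open>The preimage of an affine set under an affine map is affine. It contains
      \<open>S i\<close> by the induction hypothesis, hence also the affine hull of
      \<open>S i\<close>.\<close>
    have "affine {t. upd t \<in> affine hull cart_prod S}"
      using affine_affine_hull[of "cart_prod S"] by (auto simp: affine_def upd_comb)
    moreover have "upd t \<in> affine hull cart_prod S" if "t \<in> S i" for t
      using insert.prems insert.hyps that by (intro insert.IH) (auto simp: upd_def)
    ultimately have "affine hull S i \<subseteq> {t. upd t \<in> affine hull cart_prod S}"
      by (intro hull_minimal) auto
    moreover have "upd (y $ i) = y"
      by (simp add: upd_def vec_eq_iff)
    ultimately show ?case
      using insert.prems by force
  qed
  show "cart_prod (\<lambda>j. affine hull S j) \<subseteq> affine hull cart_prod S"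
    using *[of UNIV] by auto
qed

text \<open>The hull splits by \<open>affine_hull_cart_prod\<close>, and the pairs of points whose
  differences make up \<open>Lin\<close> can be chosen independently in each coordinate.\<close>

lemma Lin_cart_prod:
  fixes S :: "'m::finite \<Rightarrow> 'a::euclidean_space set"
  shows "Lin (cart_prod S) = cart_prod (\<lambda>j. Lin (S j))"
proof
  show "Lin (cart_prod S) \<subseteq> cart_prod (\<lambda>j. Lin (S j))"
    by (auto simp: Lin_def affine_hull_cart_prod) blast
next
  show "cart_prod (\<lambda>j. Lin (S j)) \<subseteq> Lin (cart_prod S)"
  proof
    fix v assume "v \<in> cart_prod (\<lambda>j. Lin (S j))"
    then have "\<forall>j. \<exists>x y. v $ j = y - x \<and> x \<in> S j \<and> y \<in> affine hull S j"
      by (auto simp: Lin_def)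
    then obtain x y where "\<And>j. v $ j = y j - x j \<and> x j \<in> S j \<and> y j \<in> affine hull S j"
      by metis
    then have "v = (\<chi> j. y j) - (\<chi> j. x j)" "(\<chi> j. x j) \<in> cart_prod S"
        "(\<chi> j. y j) \<in> affine hull cart_prod S"
      by (auto simp: affine_hull_cart_prod vec_eq_iff)
    then show "v \<in> Lin (cart_prod S)"
      unfolding Lin_def by blast
  qed
qed

text \<open>The distance is the L2 norm of the coordinate distances, so minimising each of them
  minimises it. \<open>closest_point\<close> chooses some minimiser; convexity and closedness of the
  product make it the only one.\<close>

lemma closest_point_cart_prod:
  fixes T :: "'m::finite \<Rightarrow> 'a::euclidean_space set"
  assumes "\<And>j. convex (T j)" "\<And>j. closed (T j)" "\<And>j. T j \<noteq> {}"
  shows "closest_point (cart_prod T) a = (\<chi> j. closest_point (T j) (a $ j))"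
proof (rule closest_point_unique[symmetric])
  show "(\<chi> j. closest_point (T j) (a $ j)) \<in> cart_prod T"
    using assms by (simp add: closest_point_in_set)
  show "\<forall>z\<in>cart_prod T. dist a (\<chi> j. closest_point (T j) (a $ j)) \<le> dist a z"
    using assms by (auto simp: dist_vec_def intro!: L2_set_mono closest_point_le)
qed (auto intro: convex_cart_prod closed_cart_prod assms)

section \<open>Differentiability\<close>

lemma has_derivative_vec_lambda:
  fixes f :: "'m::finite \<Rightarrow> 'b::real_normed_vector \<Rightarrow> 'a::euclidean_space"
  assumes "\<And>j. (f j has_derivative f' j) F"
  shows "((\<lambda>x. \<chi> j. f j x) has_derivative (\<lambda>h. \<chi> j. f' j h)) F"
proof -
  \<comment> \<open>A vector is the sum of its coordinates embedded by the bounded linear maps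
    \<open>axis j\<close>; this leaves the rules for sums and for composition with bounded linear
    maps.\<close>
  have lin: "bounded_linear (axis j :: 'a \<Rightarrow> 'a ^ 'm)" for j
    by (intro linear_conv_bounded_linear[THEN iffD1] linearI) (auto simp: axis_def vec_eq_iff)
  have sum_axis: "(\<chi> j. v j) = (\<Sum>j\<in>UNIV. axis j (v j))" for v :: "'m \<Rightarrow> 'a"
    by (simp add: vec_eq_iff axis_def)
  show ?thesis
    unfolding sum_axis
    by (intro has_derivative_sum bounded_linear.has_derivative[OF lin] assms)
qed

lemma has_vector_derivative_vec_lambda:
  fixes f :: "'m::finite \<Rightarrow> real \<Rightarrow> 'a::euclidean_space"
  assumes "\<And>j. (f j has_vector_derivative f' j) F"
  shows "((\<lambda>x. \<chi> j. f j x) has_vector_derivative (\<chi> j. f' j)) F"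
proof -
  have "(\<lambda>h::real. h *\<^sub>R (\<chi> j. f' j)) = (\<lambda>h. \<chi> j. h *\<^sub>R f' j)"
    by (simp add: vec_eq_iff fun_eq_iff)
  with has_derivative_vec_lambda[OF assms[unfolded has_vector_derivative_def]] show ?thesis
    by (simp add: has_vector_derivative_def)
qed

lemma Ck_on_imp_continuous_on: "Ck_on k S f \<Longrightarrow> continuous_on S f"
  using differentiable_imp_continuous_within[of f _ UNIV]
  by (cases k) (simp_all add: continuous_at_imp_continuous_on)

text \<open>Derivatives at a point of an open set depend only on nearby values. This is needed
  because the recursion of \<open>Ck_on\<close> goes through \<open>frechet_derivative\<close>,
  whose formula for a product map is available only at points of the set.\<close>

lemma Ck_on_cong:
  assumes "open S" "\<And>x. x \<in> S \<Longrightarrow> f x = g x" "Ck_on k S f"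
  shows "Ck_on k S g"
  using assms(2,3)
proof (induction k arbitrary: f g)
  case 0
  then show ?case by (simp cong: continuous_on_cong)
next
  case (Suc k)
  have D: "(g has_derivative frechet_derivative f (at x)) (at x)" if "x \<in> S" for x
  proof (rule has_derivative_transform_within_open)
    show "(f has_derivative frechet_derivative f (at x)) (at x)"
      using Suc.prems(2) that by (simp flip: frechet_derivative_works)
  qed (fact \<open>open S\<close> that Suc.prems(1))+
  have "Ck_on k S (\<lambda>x. frechet_derivative g (at x) v)" for v
  proof (rule Suc.IH[where f = "\<lambda>x. frechet_derivative f (at x) v"])
    show "frechet_derivative f (at x) v = frechet_derivative g (at x) v" if "x \<in> S" for x
      by (rule fun_cong[OF frechet_derivative_at[OF D[OF that]]])
    show "Ck_on k S (\<lambda>x. frechet_derivative f (at x) v)"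
      using Suc.prems(2) by simp
  qed
  moreover have "g differentiable (at x)" if "x \<in> S" for x
    using D[OF that] by (rule differentiableI)
  ultimately show ?case
    by simp
qed

text \<open>The derivative of a coordinatewise map in direction \<open>v\<close> is again
  coordinatewise, its factors being the derivatives of the \<open>f j\<close> in direction
  \<open>v $ j\<close>. Hence the induction on \<open>k\<close> with \<open>f\<close>
  arbitrary.\<close>

lemma Ck_on_cart_prod:
  fixes f :: "'m::finite \<Rightarrow> 'a::euclidean_space \<Rightarrow> 'b::euclidean_space"
  assumes "\<And>j. open (S j)" "\<And>j. Ck_on k (S j) (f j)"
  shows "Ck_on k (cart_prod S) (\<lambda>x. \<chi> j. f j (x $ j))"
  using assms(2)
proof (induction k arbitrary: f)
  case 0
  have "continuous_on (cart_prod S) (\<lambda>x. f j (x $ j))" for j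
  proof (rule continuous_on_compose2[of "S j" "f j"])
    show "continuous_on (S j) (f j)"
      using 0 by simp
  qed (auto intro: continuous_intros)
  then show ?case
    by (auto intro: continuous_on_vec_lambda)
next
  case (Suc k)
  let ?D = "\<lambda>j y. frechet_derivative (f j) (at y)"
  have D: "((\<lambda>x. \<chi> j. f j (x $ j)) has_derivative (\<lambda>h. \<chi> j. ?D j (x $ j) (h $ j))) (at x)"
    if "x \<in> cart_prod S" for x
  proof (rule has_derivative_vec_lambda)
    fix j
    have "(f j has_derivative ?D j (x $ j)) (at (x $ j))"
      using Suc.prems that by (simp flip: frechet_derivative_works)
    from has_derivative_compose[OF bounded_linear.has_derivative[OF bounded_linear_vec_nth
          has_derivative_ident] this]
    show "((\<lambda>x. f j (x $ j)) has_derivative (\<lambda>h. ?D j (x $ j) (h $ j))) (at x)" .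
  qed
  have "Ck_on k (cart_prod S) (\<lambda>x. frechet_derivative (\<lambda>x. \<chi> j. f j (x $ j)) (at x) v)" for v
  proof (rule Ck_on_cong[where f = "\<lambda>x. \<chi> j. ?D j (x $ j) (v $ j)"])
    show "Ck_on k (cart_prod S) (\<lambda>x. \<chi> j. ?D j (x $ j) (v $ j))"
      using Suc.prems by (intro Suc.IH) auto
    show "(\<chi> j. ?D j (x $ j) (v $ j)) = frechet_derivative (\<lambda>x. \<chi> j. f j (x $ j)) (at x) v"
      if "x \<in> cart_prod S" for x
      by (rule fun_cong[OF frechet_derivative_at[OF D[OF that]]])
  qed (intro open_cart_prod assms)
  moreover have "(\<lambda>x. \<chi> j. f j (x $ j)) differentiable (at x)" if "x \<in> cart_prod S" for x
    using D[OF that] by (rule differentiableI)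
  ultimately show ?case
    by simp
qed

text \<open>The flattening charts of the factors, applied coordinatewise, flatten the product to a
  piece of the product of the model subspaces.\<close>

lemma Cp_manifold_around_cart_prod:
  fixes M :: "'m::finite \<Rightarrow> 'a::euclidean_space set"
  assumes "\<And>j. Cp_manifold_around p (M j) (x $ j)"
  shows "Cp_manifold_around p (cart_prod M) x"
proof -
  have "\<forall>j. \<exists>U W \<phi> \<psi> L. open U \<and> x $ j \<in> U \<and> open W \<and> subspace (L :: 'a set) \<and>
        homeomorphism U W \<phi> \<psi> \<and> Ck_on p U \<phi> \<and> Ck_on p W \<psi> \<and> \<phi> ` (M j \<inter> U) = L \<inter> W"
    using assms by (auto simp: Cp_manifold_around_def)
  then obtain U W \<phi> \<psi> L where *: "\<And>j. open (U j)" "\<And>j. x $ j \<in> U j" "\<And>j. open (W j)"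
      "\<And>j. subspace (L j :: 'a set)" "\<And>j. homeomorphism (U j) (W j) (\<phi> j) (\<psi> j)"
      "\<And>j. Ck_on p (U j) (\<phi> j)" "\<And>j. Ck_on p (W j) (\<psi> j)"
      "\<And>j. \<phi> j ` (M j \<inter> U j) = L j \<inter> W j"
    by metis
  let ?\<phi> = "\<lambda>x. \<chi> j. \<phi> j (x $ j)" and ?\<psi> = "\<lambda>x. \<chi> j. \<psi> j (x $ j)"
  have Ck: "Ck_on p (cart_prod U) ?\<phi>" "Ck_on p (cart_prod W) ?\<psi>"
    using * by (auto intro: Ck_on_cart_prod)
  have "\<phi> j y \<in> W j" if "y \<in> U j" for j y
    using *(5)[of j] that by (auto simp: homeomorphism_def)
  moreover have "\<psi> j y \<in> U j" if "y \<in> W j" for j y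
    using *(5)[of j] that by (auto simp: homeomorphism_def)
  ultimately have "homeomorphism (cart_prod U) (cart_prod W) ?\<phi> ?\<psi>"
    using Ck[THEN Ck_on_imp_continuous_on]
      homeomorphism_apply1[OF *(5)] homeomorphism_apply2[OF *(5)]
    by (intro homeomorphismI) (auto simp: vec_eq_iff)
  moreover have "?\<phi> ` (cart_prod M \<inter> cart_prod U) = cart_prod L \<inter> cart_prod W"
    using *(8) by (simp add: cart_prod_Int image_cart_prod)
  moreover have "x \<in> cart_prod M"
    using assms by (simp add: Cp_manifold_around_def)
  ultimately show ?thesis
    unfolding Cp_manifold_around_def using Ck *
    by (intro conjI exI[where x = "cart_prod U"] exI[where x = "cart_prod W"] exI[where x = ?\<phi>]
        exI[where x = ?\<psi>] exI[where x = "cart_prod L"])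
      (auto intro: open_cart_prod subspace_cart_prod)
qed

section \<open>Tangent and normal spaces\<close>

text \<open>The coordinates of a curve in the product are curves in the factors; conversely, curves
  in the factors are run simultaneously.\<close>

lemma tangent_space_cart_prod:
  fixes M :: "'m::finite \<Rightarrow> 'a::euclidean_space set"
  shows "tangent_space (cart_prod M) x = cart_prod (\<lambda>j. tangent_space (M j) (x $ j))"
proof
  show "tangent_space (cart_prod M) x \<subseteq> cart_prod (\<lambda>j. tangent_space (M j) (x $ j))"
  proof
    fix v assume "v \<in> tangent_space (cart_prod M) x"
    then obtain \<gamma> e D where *: "e > 0" "\<gamma> ` {-e<..<e} \<subseteq> cart_prod M" "\<gamma> 0 = x"
        "(\<gamma> has_vector_derivative v) (at 0)" "continuous_on {-e<..<e} D"
        "\<And>t. t \<in> {-e<..<e} \<Longrightarrow> (\<gamma> has_vector_derivative D t) (at t)"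
      by (auto simp: tangent_space_def C1_differentiable_on_def)
    have nth: "((\<lambda>t. \<gamma> t $ j) has_vector_derivative d $ j) (at t)"
      if "(\<gamma> has_vector_derivative d) (at t)" for j d t
      using that by (rule bounded_linear.has_vector_derivative[OF bounded_linear_vec_nth])
    have "(\<lambda>t. \<gamma> t $ j) C1_differentiable_on {-e<..<e}" for j
      unfolding C1_differentiable_on_def
      using * by (intro exI[where x = "\<lambda>t. D t $ j"]) (auto intro: nth continuous_on_component)
    moreover have "(\<lambda>t. \<gamma> t $ j) ` {-e<..<e} \<subseteq> M j" for j
      using *(2) by auto
    ultimately have "v $ j \<in> tangent_space (M j) (x $ j)" for j
      unfolding tangent_space_def using * nth by blast
    then show "v \<in> cart_prod (\<lambda>j. tangent_space (M j) (x $ j))"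
      by simp
  qed
next
  show "cart_prod (\<lambda>j. tangent_space (M j) (x $ j)) \<subseteq> tangent_space (cart_prod M) x"
  proof
    fix v assume "v \<in> cart_prod (\<lambda>j. tangent_space (M j) (x $ j))"
    then have "\<forall>j. \<exists>\<gamma> e D. e > 0 \<and> \<gamma> ` {-e<..<e} \<subseteq> M j \<and> \<gamma> 0 = x $ j \<and>
        (\<gamma> has_vector_derivative v $ j) (at 0) \<and> continuous_on {-e<..<e} D \<and>
        (\<forall>t\<in>{-e<..<e}. (\<gamma> has_vector_derivative D t) (at t))"
      unfolding mem_cart_prod tangent_space_def C1_differentiable_on_def by blast
    then obtain \<gamma> e D where *: "\<And>j. e j > 0" "\<And>j. \<gamma> j ` {- e j<..<e j} \<subseteq> M j"
        "\<And>j. \<gamma> j 0 = x $ j" "\<And>j. (\<gamma> j has_vector_derivative v $ j) (at 0)"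
        "\<And>j. continuous_on {- e j<..<e j} (D j)"
        "\<And>j t. t \<in> {- e j<..<e j} \<Longrightarrow> (\<gamma> j has_vector_derivative D j t) (at t)"
      by metis
    \<comment> \<open>The given curves live on intervals of different radii. The smallest radius
      serves all of them, and it is positive because the index type is finite.\<close>
    define d where "d = Min (range e)"
    have d: "d > 0" and sub: "{-d<..<d} \<subseteq> {- e j<..<e j}" for j
    proof -
      have "d \<le> e j" by (simp add: d_def)
      then show "{-d<..<d} \<subseteq> {- e j<..<e j}" by auto
    qed (simp add: d_def *)
    define \<Gamma> where "\<Gamma> = (\<lambda>t. \<chi> j. \<gamma> j t)"
    have "\<Gamma> C1_differentiable_on {-d<..<d}"
      unfolding C1_differentiable_on_def
    proof (intro exI conjI ballI)
      show "(\<Gamma> has_vector_derivative (\<chi> j. D j t)) (at t)" if "t \<in> {-d<..<d}" for t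
        unfolding \<Gamma>_def using *(6) sub that by (blast intro: has_vector_derivative_vec_lambda)
      show "continuous_on {-d<..<d} (\<lambda>t. \<chi> j. D j t)"
        using *(5) sub by (blast intro: continuous_on_vec_lambda continuous_on_subset)
    qed
    moreover have "\<Gamma> ` {-d<..<d} \<subseteq> cart_prod M"
      unfolding \<Gamma>_def using *(2) sub by fastforce
    moreover have "(\<Gamma> has_vector_derivative v) (at 0)"
      unfolding \<Gamma>_def using has_vector_derivative_vec_lambda[of \<gamma> "\<lambda>j. v $ j", OF *(4)] by simp
    moreover have "\<Gamma> 0 = x"
      by (simp add: \<Gamma>_def * vec_eq_iff)
    ultimately show "v \<in> tangent_space (cart_prod M) x"
      unfolding tangent_space_def using d by blast
  qed
qed

text \<open>The constant curve has velocity zero. This provides tangent vectors of a product that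
  are supported in a single coordinate.\<close>

lemma zero_in_tangent_space:
  assumes "x \<in> M"
  shows "0 \<in> tangent_space M x"
  unfolding tangent_space_def
  using assms by (auto intro!: exI[where x = "\<lambda>t. x"] exI[where x = 1])

lemma normal_space_cart_prod:
  fixes M :: "'m::finite \<Rightarrow> 'a::euclidean_space set"
  assumes "x \<in> cart_prod M"
  shows "normal_space (cart_prod H) (cart_prod M) x =
    cart_prod (\<lambda>j. normal_space (H j) (M j) (x $ j))"
proof
  show "cart_prod (\<lambda>j. normal_space (H j) (M j) (x $ j)) \<subseteq>
      normal_space (cart_prod H) (cart_prod M) x"
    by (auto simp: normal_space_def tangent_space_cart_prod orthogonal_def inner_vec_def
        intro!: sum.neutral)
next
  show "normal_space (cart_prod H) (cart_prod M) x \<subseteq>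
      cart_prod (\<lambda>j. normal_space (H j) (M j) (x $ j))"
  proof
    fix n assume n: "n \<in> normal_space (cart_prod H) (cart_prod M) x"
    have "orthogonal (n $ j) t" if "t \<in> tangent_space (M j) (x $ j)" for j t
    proof -
      \<comment> \<open>The test vector is \<open>t\<close> in coordinate \<open>j\<close> and zero
        elsewhere; orthogonality to it isolates \<open>n $ j\<close>.\<close>
      have "axis j t \<in> tangent_space (cart_prod M) x"
        using that assms by (auto simp: tangent_space_cart_prod axis_def zero_in_tangent_space)
      with n have "orthogonal n (axis j t)"
        by (simp add: normal_space_def)
      then show ?thesis
        by (simp add: orthogonal_def inner_axis)
    qed
    with n show "n \<in> cart_prod (\<lambda>j. normal_space (H j) (M j) (x $ j))"
      by (simp add: normal_space_def)
  qed
qed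

text \<open>The chart carries curves in \<open>M\<close> near \<open>x\<close> to curves in the flat
  piece \<open>L \<inter> W\<close> and back, and the velocities of curves in the flat piece are
  exactly the vectors of \<open>L\<close>. In this form the tangent space is visibly a linear
  subspace.\<close>

lemma tangent_space_eq_image:
  fixes M :: "'a::euclidean_space set" and \<phi> \<psi> :: "'a \<Rightarrow> 'a"
  assumes "open U" "open W" "subspace L" and hom: "homeomorphism U W \<phi> \<psi>"
    and "Ck_on p U \<phi>" "Ck_on p W \<psi>" "1 \<le> p" and flat: "\<phi> ` (M \<inter> U) = L \<inter> W"
    and x: "x \<in> M" "x \<in> U"
  shows "tangent_space M x = frechet_derivative \<psi> (at (\<phi> x)) ` L"
proof -
  obtain k where p: "p = Suc k"
    using \<open>1 \<le> p\<close> by (cases p) auto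
  have \<phi>: "(\<phi> has_derivative frechet_derivative \<phi> (at y)) (at y)" if "y \<in> U" for y
    using that \<open>Ck_on p U \<phi>\<close> by (simp add: p flip: frechet_derivative_works)
  have \<psi>: "(\<psi> has_derivative frechet_derivative \<psi> (at y)) (at y)" if "y \<in> W" for y
    using that \<open>Ck_on p W \<psi>\<close> by (simp add: p flip: frechet_derivative_works)
  have \<psi>_cont: "continuous_on W (\<lambda>y. frechet_derivative \<psi> (at y) w)" for w
    using \<open>Ck_on p W \<psi>\<close> by (auto simp: p intro: Ck_on_imp_continuous_on)
  have \<phi>x: "\<phi> x \<in> L" "\<phi> x \<in> W" "\<psi> (\<phi> x) = x"
    using x flat hom by (auto simp: homeomorphism_def)
  show ?thesis
  proof (intro equalityI subsetI)
    fix v assume "v \<in> tangent_space M x"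
    then obtain \<gamma> e where e: "e > 0" and \<gamma>: "\<gamma> ` {-e<..<e} \<subseteq> M" "\<gamma> 0 = x"
        "(\<gamma> has_vector_derivative v) (at 0)"
      by (auto simp: tangent_space_def)
    have "(\<gamma> \<longlongrightarrow> x) (at 0)"
      using has_vector_derivative_continuous[OF \<gamma>(3)] \<gamma>(2) by (simp add: isCont_def)
    then have "\<forall>\<^sub>F t in at 0. \<gamma> t \<in> U"
      using \<open>open U\<close> \<open>x \<in> U\<close> by (rule topological_tendstoD)
    moreover have "\<forall>\<^sub>F t in at 0. t \<in> {-e<..<e}"
      using e by (intro eventually_at_in_open') auto
    \<comment> \<open>The curve may leave \<open>U\<close> away from 0, so flatness is available
      only for small \<open>t\<close>.\<close>
    ultimately have near: "\<forall>\<^sub>F t in at 0. \<gamma> t \<in> M \<inter> U"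
      by eventually_elim (use \<gamma> in auto)
    define w where "w = frechet_derivative \<phi> (at x) v"
    have w: "((\<phi> \<circ> \<gamma>) has_vector_derivative w) (at 0)"
      unfolding w_def using \<phi>[OF \<open>x \<in> U\<close>] \<gamma>
      by (intro vector_derivative_diff_chain_within[of \<gamma> v 0 UNIV \<phi>, simplified])
        (auto intro: has_derivative_at_withinI)
    \<comment> \<open>The remainder form of the derivative is turned into convergence of difference
      quotients, to which closedness of \<open>L\<close> can be applied.\<close>
    have lim: "((\<lambda>t. (\<phi> (\<gamma> t) - \<phi> x) /\<^sub>R t) \<longlongrightarrow> w) (at 0)"
    proof (subst Lim_null, rule tendsto_norm_zero_cancel, rule Lim_transform_eventually)
      show "((\<lambda>t. norm (\<phi> (\<gamma> t) - \<phi> x - t *\<^sub>R w) / norm t) \<longlongrightarrow> 0) (at 0)"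
        using w \<gamma>(2) by (simp add: has_vector_derivative_def has_derivative_at)
      have "norm (y - t *\<^sub>R w) / norm t = norm (y /\<^sub>R t - w)" if "t \<noteq> 0" for y t
      proof -
        have "y /\<^sub>R t - w = (y - t *\<^sub>R w) /\<^sub>R t"
          using that by (simp add: scaleR_diff_right)
        then show ?thesis
          by (simp add: divide_inverse_commute)
      qed
      then show "\<forall>\<^sub>F t in at 0. norm (\<phi> (\<gamma> t) - \<phi> x - t *\<^sub>R w) / norm t =
          norm ((\<phi> (\<gamma> t) - \<phi> x) /\<^sub>R t - w)"
        by (auto simp: eventually_at_filter)
    qed
    \<comment> \<open>Both \<open>\<phi> (\<gamma> t)\<close> and \<open>\<phi> x\<close> lie in
      \<open>L\<close>, hence so do the quotients; a subspace of a Euclidean space is closed and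
      contains their limit.\<close>
    have "w \<in> L"
    proof (rule Lim_in_closed_set[OF closed_subspace[OF \<open>subspace L\<close>] _ _ lim])
      show "\<forall>\<^sub>F t in at 0. (\<phi> (\<gamma> t) - \<phi> x) /\<^sub>R t \<in> L"
        using near
      proof eventually_elim
        case (elim t)
        then have "\<phi> (\<gamma> t) \<in> L" using flat by blast
        then show ?case
          using \<phi>x \<open>subspace L\<close> by (intro subspace_mul subspace_diff)
      qed
    qed simp
    have "((\<psi> \<circ> (\<phi> \<circ> \<gamma>)) has_vector_derivative frechet_derivative \<psi> (at (\<phi> x)) w) (at 0)"
      using w \<psi>[OF \<phi>x(2)] \<gamma>(2)
      by (intro vector_derivative_diff_chain_within[of "\<phi> \<circ> \<gamma>" w 0 UNIV \<psi>, simplified])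
        (auto intro: has_derivative_at_withinI)
    \<comment> \<open>Going through the chart and back reproduces \<open>\<gamma>\<close> near 0,
      including at 0 itself, so the velocity is also \<open>v\<close>; uniqueness of derivatives
      gives the preimage \<open>w\<close>.\<close>
    moreover have "((\<psi> \<circ> (\<phi> \<circ> \<gamma>)) has_vector_derivative v) (at 0)"
    proof (rule has_vector_derivative_cong_ev[THEN iffD1, OF _ _ \<gamma>(3)])
      show "\<forall>\<^sub>F t in nhds 0. t \<in> UNIV \<longrightarrow> \<gamma> t = (\<psi> \<circ> (\<phi> \<circ> \<gamma>)) t"
        unfolding eventually_nhds_conv_at
        using near hom \<gamma>(2) \<phi>x by (auto elim!: eventually_mono simp: homeomorphism_def)
    qed (use \<gamma>(2) \<phi>x in simp)
    ultimately have "v = frechet_derivative \<psi> (at (\<phi> x)) w"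
      by (rule vector_derivative_unique_at[symmetric])
    with \<open>w \<in> L\<close> show "v \<in> frechet_derivative \<psi> (at (\<phi> x)) ` L"
      by blast
  next
    fix v assume "v \<in> frechet_derivative \<psi> (at (\<phi> x)) ` L"
    then obtain w where w: "w \<in> L" "v = frechet_derivative \<psi> (at (\<phi> x)) w"
      by blast
    \<comment> \<open>Conversely, \<open>v\<close> is realised by the straight line through
      \<open>\<phi> x\<close> in direction \<open>w\<close>, mapped by \<open>\<psi>\<close>. The
      line stays in \<open>L\<close>, and for small \<open>t\<close> in the open set
      \<open>W\<close>.\<close>
    define c where "c = (\<lambda>t::real. \<phi> x + t *\<^sub>R w)"
    have c_cont: "continuous_on S c" for S
      unfolding c_def by (intro continuous_intros)
    have "open (c -` W)"
      using continuous_open_vimage[OF \<open>open W\<close>, of c] c_cont[of UNIV]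
      by (simp add: continuous_on_eq_continuous_at)
    moreover have "0 \<in> c -` W"
      using \<phi>x by (simp add: c_def)
    ultimately obtain e where e: "e > 0" "ball 0 e \<subseteq> c -` W"
      by (meson openE)
    then have cW: "c t \<in> W" if "t \<in> {-e<..<e}" for t
      using that by (auto simp: subset_iff dist_real_def)
    have deriv: "((\<psi> \<circ> c) has_vector_derivative frechet_derivative \<psi> (at (c t)) w) (at t)"
      if "c t \<in> W" for t
    proof (rule vector_derivative_diff_chain_within[of c w t UNIV \<psi>, simplified])
      show "(c has_vector_derivative w) (at t)"
        unfolding c_def by (auto intro!: derivative_eq_intros)
      show "(\<psi> has_derivative frechet_derivative \<psi> (at (c t))) (at (c t) within range c)"
        using \<psi>[OF that] by (rule has_derivative_at_withinI)
    qed
    \<comment> \<open>The velocity at \<open>t\<close> is the derivative of \<open>\<psi>\<close> at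
      \<open>c t\<close> in the fixed direction \<open>w\<close>, so its continuity is that of one
      directional derivative of \<open>\<psi>\<close>.\<close>
    have "(\<psi> \<circ> c) C1_differentiable_on {-e<..<e}"
      unfolding C1_differentiable_on_def
      using cW deriv
      by (intro exI[where x = "\<lambda>t. frechet_derivative \<psi> (at (c t)) w"])
        (auto intro!: continuous_on_compose2[OF \<psi>_cont c_cont])
    moreover have "(\<psi> \<circ> c) ` {-e<..<e} \<subseteq> M"
    proof clarsimp
      fix t assume t: "- e < t" "t < e"
      have "c t \<in> L"
        unfolding c_def using w \<phi>x \<open>subspace L\<close> by (intro subspace_add subspace_mul)
      then have "c t \<in> \<phi> ` (M \<inter> U)"
        using cW t flat by simp
      then show "\<psi> (c t) \<in> M"
        using hom by (auto simp: homeomorphism_def)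
    qed
    moreover have "(\<psi> \<circ> c) 0 = x"
      using \<phi>x by (simp add: c_def)
    moreover have "((\<psi> \<circ> c) has_vector_derivative v) (at 0)"
      using deriv[of 0] \<phi>x w by (simp add: c_def)
    ultimately show "v \<in> tangent_space M x"
      unfolding tangent_space_def using e by blast
  qed
qed

text \<open>One chart serves all points of \<open>M\<close> in its domain, and the image of
  \<open>L\<close> under a linear derivative is a subspace.\<close>

lemma Cp_manifold_around_subspace_tangent_space:
  assumes "Cp_manifold_around p M x" "1 \<le> p"
  obtains U where "open U" "x \<in> U" "\<And>y. y \<in> M \<inter> U \<Longrightarrow> subspace (tangent_space M y)"
proof -
  from assms obtain U W \<phi> \<psi> L where *: "open U" "x \<in> U" "open W" "subspace (L :: 'a set)"
      "homeomorphism U W \<phi> \<psi>" "Ck_on p U \<phi>" "Ck_on p W \<psi>" "\<phi> ` (M \<inter> U) = L \<inter> W"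
    unfolding Cp_manifold_around_def by blast
  have "subspace (tangent_space M y)" if "y \<in> M \<inter> U" for y
  proof -
    have "\<phi> y \<in> W"
      using *(8) that by blast
    then have "\<psi> differentiable at (\<phi> y)"
      using \<open>Ck_on p W \<psi>\<close> \<open>1 \<le> p\<close> by (cases p) auto
    moreover have "tangent_space M y = frechet_derivative \<psi> (at (\<phi> y)) ` L"
      using * assms(2) that by (intro tangent_space_eq_image) auto
    ultimately show ?thesis
      using \<open>subspace L\<close> by (simp add: linear_frechet_derivative linear_subspace_image)
  qed
  with * show thesis
    by (intro that) auto
qed

section \<open>Partial smoothness\<close>

lemma usc_at_along_prod_operator:
  fixes A :: "'m::finite \<Rightarrow> 'a::euclidean_space \<Rightarrow> 'a set"
  assumes "\<And>j. usc_at_along (S j) (A j) (x $ j)"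
  shows "usc_at_along (cart_prod S) (prod_operator A) x"
  unfolding usc_at_along_def
proof (intro allI impI)
  fix X V u
  assume *: "(\<forall>k::nat. X k \<in> cart_prod S \<and> V k \<in> prod_operator A (X k)) \<and> X \<longlonglongrightarrow> x \<and> V \<longlonglongrightarrow> u"
  have "u $ j \<in> A j (x $ j)" for j
    using assms[of j, unfolded usc_at_along_def, rule_format,
        of "\<lambda>k. X k $ j" "\<lambda>k. V k $ j" "u $ j"] *
    by (auto simp: prod_operator_def intro: tendsto_vec_nth)
  then show "u \<in> prod_operator A x"
    by (simp add: prod_operator_def)
qed

text \<open>Approximating sequences are found separately for the coordinates of \<open>u\<close> and
  then combined. A nonempty product has nonempty factors, so each coordinate sequence stays in the
  domain of its \<open>A j\<close>.\<close>

lemma lsc_at_along_prod_operator: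
  fixes A :: "'m::finite \<Rightarrow> 'a::euclidean_space \<Rightarrow> 'a set"
  assumes "\<And>j. lsc_at_along (S j) (A j) (x $ j)"
  shows "lsc_at_along (cart_prod S) (prod_operator A) x"
  unfolding lsc_at_along_def
proof (intro ballI allI impI)
  fix u and X :: "nat \<Rightarrow> 'a ^ 'm"
  assume u: "u \<in> prod_operator A x"
    and X: "(\<forall>k. X k \<in> cart_prod S \<and> prod_operator A (X k) \<noteq> {}) \<and> X \<longlonglongrightarrow> x"
  have "\<forall>j. \<exists>V. (\<forall>k. V k \<in> A j (X k $ j)) \<and> V \<longlonglongrightarrow> u $ j"
  proof
    fix j
    show "\<exists>V. (\<forall>k. V k \<in> A j (X k $ j)) \<and> V \<longlonglongrightarrow> u $ j"
      using assms[of j, unfolded lsc_at_along_def, rule_format, of "u $ j" "\<lambda>k. X k $ j"] u X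
      by (auto simp: prod_operator_eq cart_prod_eq_empty_iff intro: tendsto_vec_nth)
  qed
  then obtain V where "\<And>j k. V j k \<in> A j (X k $ j)" "\<And>j. V j \<longlonglongrightarrow> u $ j"
    by metis
  then show "\<exists>V. (\<forall>k. V k \<in> prod_operator A (X k)) \<and> V \<longlonglongrightarrow> u"
    by (intro exI[where x = "\<lambda>k. \<chi> j. V j k"])
      (auto simp: prod_operator_def intro!: vec_tendstoI)
qed

lemma sharpness_prod_operator:
  fixes A :: "'m::finite \<Rightarrow> 'a::euclidean_space \<Rightarrow> 'a set"
  assumes sharp: "\<And>j. sharpness (H j) (A j) (M j) (x $ j)"
    and mfd: "\<And>j. Cp_manifold_around p (M j) (x $ j)" "1 \<le> p"
  shows "sharpness (cart_prod H) (prod_operator A) (cart_prod M) x"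
proof -
  have "x \<in> cart_prod M"
    using mfd by (simp add: Cp_manifold_around_def)
  then have normal: "normal_space (cart_prod H) (cart_prod M) x = Lin (prod_operator A x)"
    using sharp by (simp add: normal_space_cart_prod prod_operator_eq Lin_cart_prod sharpness_def)
  have "\<forall>j. \<exists>U. open U \<and> x $ j \<in> U \<and> (\<forall>y\<in>M j \<inter> U. subspace (tangent_space (M j) y))"
    using Cp_manifold_around_subspace_tangent_space[OF mfd] by metis
  then obtain U where U: "\<And>j. open (U j)" "\<And>j. x $ j \<in> U j"
      "\<And>j y. y \<in> M j \<inter> U j \<Longrightarrow> subspace (tangent_space (M j) y)"
    by metis
  have "\<forall>j. \<exists>V f. open V \<and> x $ j \<in> V \<and> continuous_on (M j \<inter> V) f \<and>
      (\<forall>y\<in>M j \<inter> V. closest_point (tangent_space (M j) y) ` A j y = {f y})"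
    using sharp by (simp add: sharpness_def)
  then obtain V f where V: "\<And>j. open (V j)" "\<And>j. x $ j \<in> V j"
      "\<And>j. continuous_on (M j \<inter> V j) (f j)"
      "\<And>j y. y \<in> M j \<inter> V j \<Longrightarrow> closest_point (tangent_space (M j) y) ` A j y = {f j y}"
    by metis
  \<comment> \<open>On \<open>?W\<close> the tangent spaces of the factors are subspaces, thanks to
    \<open>U\<close>, and the projections are single-valued and continuous, thanks to
    \<open>V\<close>.\<close>
  let ?W = "cart_prod (\<lambda>j. U j \<inter> V j)" and ?f = "\<lambda>y. \<chi> j. f j (y $ j)"
  have "continuous_on (cart_prod M \<inter> ?W) ?f"
    by (rule continuous_on_vec_lambda, rule continuous_on_compose2[OF V(3)])
      (auto intro: continuous_intros)
  moreover have "closest_point (tangent_space (cart_prod M) y) ` prod_operator A y = {?f y}"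
    if "y \<in> cart_prod M \<inter> ?W" for y
  proof -
    let ?T = "\<lambda>j. tangent_space (M j) (y $ j)"
    have T: "subspace (?T j)" for j
      using U(3) that by simp
    \<comment> \<open>Subspaces are nonempty, convex and closed, which is what the splitting of
      \<open>closest_point\<close> asks for.\<close>
    have "closest_point (tangent_space (cart_prod M) y) =
        (\<lambda>a. \<chi> j. closest_point (?T j) (a $ j))"
      unfolding tangent_space_cart_prod
      using T subspace_0[OF T]
      by (intro ext closest_point_cart_prod subspace_imp_convex closed_subspace) auto
    \<comment> \<open>A coordinatewise map sends a product to the product of the images, here a
      product of singletons.\<close>
    then have "closest_point (tangent_space (cart_prod M) y) ` prod_operator A y =
        cart_prod (\<lambda>j. closest_point (?T j) ` A j (y $ j))"
      by (simp only: prod_operator_eq image_cart_prod[where f = "\<lambda>j. closest_point (?T j)"])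
    also have "\<dots> = {?f y}"
      using V(4) that by (simp add: cart_prod_singleton)
    finally show ?thesis .
  qed
  moreover have "open ?W"
    using U V by (intro open_cart_prod open_Int)
  moreover have "x \<in> ?W"
    using U V by simp
  ultimately show ?thesis
    unfolding sharpness_def using normal by blast
qed

theorem theorem2:
  fixes p :: nat
    and H M :: "'m::finite \<Rightarrow> 'a::euclidean_space set"
    and A :: "'m \<Rightarrow> 'a \<Rightarrow> 'a set"
    and xb :: "'m \<Rightarrow> 'a"
  assumes "\<And>j. partly_smooth p (H j) (A j) (M j) (xb j)"
  shows "partly_smooth p (cart_prod H) (prod_operator A) (cart_prod M) (\<chi> j. xb j)"
proof -
  let ?x = "\<chi> j. xb j"
  have ps: "partly_smooth p (H j) (A j) (M j) (?x $ j)" for j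
    using assms by simp
  note ps = ps[unfolded partly_smooth_def]
  have "upper_semicontinuous (cart_prod H) (prod_operator A)"
    unfolding upper_semicontinuous_def
  proof (intro ballI impI)
    \<comment> \<open>Upper semicontinuity is demanded on the domain only; a nonempty product value
      puts every \<open>x $ j\<close> in the domain of \<open>A j\<close>.\<close>
    fix x assume "x \<in> cart_prod H" "prod_operator A x \<noteq> {}"
    with ps show "usc_at_along (cart_prod H) (prod_operator A) x"
      by (intro usc_at_along_prod_operator)
        (simp add: upper_semicontinuous_def prod_operator_eq cart_prod_eq_empty_iff)
  qed
  moreover have "regularity (cart_prod H) (prod_operator A) ?x"
  proof -
    \<comment> \<open>The neighbourhoods on which the factors are regular combine to one
      neighbourhood of \<open>?x\<close>, and products inherit nonemptiness, closedness and
      convexity.\<close>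
    have "\<forall>\<^sub>F x in nhds ?x. \<forall>j. x $ j \<in> H j \<longrightarrow>
        A j (x $ j) \<noteq> {} \<and> closed (A j (x $ j)) \<and> convex (A j (x $ j))"
      by (rule eventually_nhds_vec_nth) (use ps in \<open>simp add: regularity_def\<close>)
    then show ?thesis
      unfolding regularity_def
      by eventually_elim (auto simp: prod_operator_eq cart_prod_eq_empty_iff
          intro: closed_cart_prod convex_cart_prod)
  qed
  moreover have "continuity_along (prod_operator A) (cart_prod M) ?x"
  proof -
    have "\<forall>\<^sub>F x in nhds ?x. \<forall>j. x $ j \<in> M j \<longrightarrow>
        lsc_at_along (M j) (A j) (x $ j) \<and> usc_at_along (M j) (A j) (x $ j)"
      by (rule eventually_nhds_vec_nth) (use ps in \<open>simp add: continuity_along_def\<close>)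
    then show ?thesis
      unfolding continuity_along_def
      by eventually_elim (auto intro: lsc_at_along_prod_operator usc_at_along_prod_operator)
  qed
  moreover have "sharpness (cart_prod H) (prod_operator A) (cart_prod M) ?x"
    using ps by (intro sharpness_prod_operator[where p = p]) auto
  moreover have "Cp_manifold_around p (cart_prod M) ?x"
    using ps by (intro Cp_manifold_around_cart_prod) auto
  moreover have "subspace (cart_prod H)"
    using ps by (intro subspace_cart_prod) auto
  moreover have "\<forall>x\<in>cart_prod H. prod_operator A x \<subseteq> cart_prod H"
    using ps by (auto simp: prod_operator_eq) blast
  moreover have "cart_prod M \<subseteq> cart_prod H"
    using ps by auto blast
  moreover have "?x \<in> cart_prod M" "1 \<le> p"
    using ps by auto
  ultimately show ?thesis
    by (simp add: partly_smooth_def)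
qed

end
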